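(* For all sufficiently large $x$ one has $$\frac{\sqrt{x}}{\log x} \ll A(x) - \frac{6}{\pi^2} x \ll x^{4/5},$$ with absolute implied constants. In particular, $A(x) > |\mathrm{SF} \cap [x]|$ for all sufficiently large $x$.
   Context: $\mathrm{SF}$ denotes the set of squarefree positive integers and $[x] = \{n \in \mathbb{N} : n \le x\}$. A set $B \subseteq \mathbb{N}$ is admissible if for each prime $p$ there is a residue class $b_p \pmod{p^2}$ containing no element of $B$. $A(x)$ denotes the maximum of $|B \cap [x]|$ over all admissible sets $B \subseteq \mathbb{N}$. $X \ll Y$ means $|X| \le CY$ for an absolute constant $C$. *)

theory Defs
  imports
    Complex_Main
    "HOL-Computational_Algebra.Squarefree"
    "HOL-Number_Theory.Number_Theory"
begin

text \<open>
  The natural numbers are positive here, so \<open>0\<close> is excluded from \<open>[x]\<close> and from admissible sets.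
\<close>

definition initial :: "real \<Rightarrow> nat set" where
  "initial x = {n. 0 < n \<and> real n \<le> x}"

definition SF :: "nat set" where
  "SF = {n. 0 < n \<and> squarefree n}"

definition admissible :: "nat set \<Rightarrow> bool" where
  "admissible B \<longleftrightarrow> B \<subseteq> {0<..} \<and> (\<forall>p. prime p \<longrightarrow> (\<exists>b. \<forall>n\<in>B. \<not> [n = b] (mod p ^ 2)))"

definition max_admissible :: "real \<Rightarrow> nat" where
  "max_admissible x = Max {card (B \<inter> initial x) | B. admissible B}"

lemma finite_initial: "finite (initial x)"
proof (rule finite_subset)
  show "initial x \<subseteq> {..nat \<lfloor>x\<rfloor>}"
    by (auto simp: initial_def le_nat_floor)
qed simp

text \<open>
  The maximum defining \<^const>\<open>max_admissible\<close> is over a finite nonempty set, hence is attained.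
\<close>

lemma max_admissible_wf:
  "finite {card (B \<inter> initial x) | B. admissible B}"
  "{card (B \<inter> initial x) | B. admissible B} \<noteq> {}"
proof -
  have "{card (B \<inter> initial x) | B. admissible B} \<subseteq> {..card (initial x)}"
    by (auto intro!: card_mono finite_initial)
  then show "finite {card (B \<inter> initial x) | B. admissible B}"
    by (rule finite_subset) simp
  have "admissible {}"
    by (simp add: admissible_def)
  then show "{card (B \<inter> initial x) | B. admissible B} \<noteq> {}"
    by blast
qed

end

(*
  Lower bound: removing the least populated class modulo p^2 greedily for all p <= sqrt x leaves
  at least floor(x) * prod_{p <= sqrt x} (1 - 1/p^2) integers, and no class has to be removed for
  larger p.  The omitted factors of 6/pi^2 = prod_p (1 - 1/p^2) contribute a relative gain
  sum_{p > sqrt x} 1/p^2, which is >> 1/(sqrt x log x) by Chebyshev.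

  Upper bound: if B avoids b_p modulo p^2 for all p, then the square of
  sum_{d <= D} mu(d) 1[n = b_p (mod p^2) for all p | d] is 1 on B.  Summing it over n <= x gives
  6/pi^2 x + O(x D^{-1/2} + D^2), and D = x^{2/5} balances the two error terms.

  Comparison with squarefree numbers: for a prime p with sqrt x / 5 < p <= sqrt x, give up avoiding
  the class 0 modulo p^2, so that p^2 itself is gained, and avoid instead a class modulo p^2 whose
  at most 25 members in [x] are, by the Chinese remainder theorem, each divisible by the square
  of another prime.  Comparing both counts with 6/pi^2 x would require the prime number theorem.
*)

theory Submission
  imports Defs "HOL-Analysis.Gamma_Function" "HOL-Real_Asymp.Real_Asymp"
begin

subsection \<open>A Chebyshev bound for primes in \<open>(y, 5y]\<close>\<close>

text \<open>Legendre's formula, cut off at \<open>L\<close>, where all later terms vanish. Passing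
  from \<open>n\<close> to \<open>Suc n\<close> raises the floor \<open>n div p ^ i\<close> by one
  exactly when \<open>p ^ i\<close> divides \<open>Suc n\<close>, and the number of such
  \<open>i\<close> is the multiplicity of \<open>p\<close> in \<open>Suc n\<close>.\<close>

lemma multiplicity_fact:
  fixes p n L :: nat
  assumes "prime p" "n < p ^ Suc L"
  shows "multiplicity p (fact n :: nat) = (\<Sum>i=1..L. n div p ^ i)"
  using assms(2)
proof (induction n)
  case 0
  show ?case by simp
next
  case (Suc n)
  have "multiplicity p (Suc n) = card {i\<in>{1..L}. p ^ i dvd Suc n}"
  proof -
    have "multiplicity p (Suc n) \<le> L"
    proof (rule ccontr)
      assume "\<not> multiplicity p (Suc n) \<le> L"
      then have "p ^ Suc L dvd Suc n"
        by (intro multiplicity_dvd') auto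
      then show False
        using Suc.prems by (auto dest: dvd_imp_le)
    qed
    moreover have "p ^ i dvd Suc n \<longleftrightarrow> i \<le> multiplicity p (Suc n)" for i
      using assms(1) by (intro power_dvd_iff_le_multiplicity) auto
    ultimately have "{i\<in>{1..L}. p ^ i dvd Suc n} = {1..multiplicity p (Suc n)}"
      by (simp only: set_eq_iff mem_Collect_eq atLeastAtMost_iff) (use le_trans in blast)
    then show ?thesis by (simp only: card_atLeastAtMost diff_Suc_1)
  qed
  also have "\<dots> = (\<Sum>i=1..L. if p ^ i dvd Suc n then 1 else 0)"
    by (simp add: sum.If_cases Int_def)
  finally have "multiplicity p (fact (Suc n) :: nat) =
      (\<Sum>i=1..L. if p ^ i dvd Suc n then 1 else 0) + (\<Sum>i=1..L. n div p ^ i)"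
    using assms(1) Suc by (simp add: prime_elem_multiplicity_mult_distrib del: mult_Suc)
  also have "\<dots> = (\<Sum>i=1..L. Suc n div p ^ i)"
    unfolding sum.distrib [symmetric] by (intro sum.cong refl) (auto simp: div_Suc dvd_eq_mod_eq_0)
  finally show ?case .
qed

text \<open>By Legendre's formula the multiplicity is a sum over \<open>i = 1..L\<close> of
  \<open>m div p ^ i - k div p ^ i - (m - k) div p ^ i\<close>. Each term is at most 1, so the
  multiplicity is at most \<open>L\<close>, where \<open>p ^ L\<close> is the largest power of
  \<open>p\<close> up to \<open>m\<close>.\<close>

lemma power_multiplicity_binomial_le:
  fixes p m k :: nat
  assumes "prime p" "k \<le> m" "0 < m"
  shows "p ^ multiplicity p (m choose k) \<le> m"
proof -
  have p: "1 < p" using assms(1) prime_gt_1_nat by blast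
  obtain L where L: "p ^ L \<le> m" "m < p ^ Suc L"
    using ex_power_ivl1 [of p m] p assms(3) by (metis One_nat_def Suc_eq_plus1 Suc_leI numeral_2_eq_2)
  have mf: "multiplicity p (fact n :: nat) = (\<Sum>i=1..L. n div p ^ i)" if "n \<le> m" for n
    using assms(1) that L(2) by (intro multiplicity_fact) linarith+
  have "multiplicity p (fact m :: nat) =
      multiplicity p (fact k * fact (m - k) * (m choose k) :: nat)"
    using binomial_fact_lemma [OF assms(2)] by simp
  also have "\<dots> = multiplicity p (fact k :: nat) + multiplicity p (fact (m - k) :: nat)
      + multiplicity p (m choose k)"
    using assms by (simp add: prime_elem_multiplicity_mult_distrib binomial_eq_0_iff)
  finally have "(\<Sum>i=1..L. m div p ^ i) = (\<Sum>i=1..L. k div p ^ i) + (\<Sum>i=1..L. (m - k) div p ^ i)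
      + multiplicity p (m choose k)"
    unfolding mf [OF order_refl] mf [OF assms(2)] mf [OF diff_le_self] .
  moreover have "(\<Sum>i=1..L. m div p ^ i) \<le> (\<Sum>i=1..L. k div p ^ i + (m - k) div p ^ i + 1)"
  proof (intro sum_mono)
    fix i
    define q where "q = p ^ i"
    have "0 < q" using p by (simp add: q_def)
    \<comment> \<open>The two remainders modulo \<open>q\<close> add up to less than
      \<open>2 * q\<close>.\<close>
    have "k + (m - k) < (k div q + (m - k) div q + 2) * q"
      using div_mult_mod_eq [of k q] div_mult_mod_eq [of "m - k" q]
        mod_less_divisor [OF \<open>0 < q\<close>, of k] mod_less_divisor [OF \<open>0 < q\<close>, of "m - k"]
      unfolding add_mult_distrib by linarith
    then have "m div q < k div q + (m - k) div q + 2"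
      using assms(2) by (simp add: less_mult_imp_div_less)
    then show "m div p ^ i \<le> k div p ^ i + (m - k) div p ^ i + 1"
      unfolding q_def by simp
  qed
  moreover have "(\<Sum>i=1..L. k div p ^ i + (m - k) div p ^ i + 1)
      = (\<Sum>i=1..L. k div p ^ i) + (\<Sum>i=1..L. (m - k) div p ^ i) + L"
    unfolding sum.distrib by simp
  ultimately have "multiplicity p (m choose k) \<le> L"
    by linarith
  then have "p ^ multiplicity p (m choose k) \<le> p ^ L"
    using p by (intro power_increasing) auto
  also note L(1)
  finally show ?thesis .
qed

text \<open>Erdos's argument by strong induction. An even \<open>n > 2\<close> is not prime, so it
  adds nothing. For \<open>n = 2 * m + 1\<close> the primes up to \<open>m + 1\<close> are covered
  by induction, and those in \<open>(m + 1, 2 * m + 1]\<close> all divide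
  \<open>2 * m + 1 choose m\<close>, which is at most \<open>4 ^ m\<close>.\<close>

lemma primorial_le: "\<Prod>{p. prime p \<and> p \<le> n} \<le> (4 :: nat) ^ n"
proof (induction n rule: less_induct)
  case (less n)
  have fin: "finite {p :: nat. prime p \<and> p \<le> k}" for k
    by (rule finite_subset [of _ "{..k}"]) auto
  have "n \<le> 1 \<or> n = 2 \<or> n > 2" by linarith
  then consider "n \<le> 1" | "n = 2" | "n > 2" "even n" | "n > 2" "odd n"
    by blast
  then show ?case
  proof cases
    case 1
    then have "{p :: nat. prime p \<and> p \<le> n} = {}"
      by (auto dest: prime_gt_1_nat)
    then show ?thesis by (simp del: Collect_empty_eq)
  next
    case 2
    then have "{p :: nat. prime p \<and> p \<le> n} = {2}"
      by (auto dest: prime_gt_1_nat)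
    then show ?thesis using 2 by (simp del: Collect_empty_eq)
  next
    case 3
    have "p \<le> n \<longleftrightarrow> p \<le> n - 1" if "prime p" for p
    proof -
      have "p \<noteq> n"
        using that 3 primes_dvd_imp_eq two_is_prime_nat by blast
      then show ?thesis using 3 by linarith
    qed
    then have "{p :: nat. prime p \<and> p \<le> n} = {p. prime p \<and> p \<le> n - 1}"
      by auto
    then have "\<Prod>{p :: nat. prime p \<and> p \<le> n} \<le> 4 ^ (n - 1)"
      using less [of "n - 1"] 3 by simp
    also have "\<dots> \<le> 4 ^ n" by (intro power_increasing) auto
    finally show ?thesis .
  next
    case 4
    then obtain m where 4: "n = 2 * m + 1" "m > 0"
      by (auto elim: oddE)
    let ?Q = "{p :: nat. prime p \<and> m + 1 < p \<and> p \<le> 2 * m + 1}"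
    have "{p :: nat. prime p \<and> p \<le> n} = {p. prime p \<and> p \<le> m + 1} \<union> ?Q"
      using 4 by auto
    then have "\<Prod>{p :: nat. prime p \<and> p \<le> n} = \<Prod>{p. prime p \<and> p \<le> m + 1} * \<Prod>?Q"
      using fin [of n] by (auto intro!: prod.union_disjoint)
    also have "\<dots> \<le> 4 ^ (m + 1) * 4 ^ m"
    proof (intro mult_mono)
      show "\<Prod>{p :: nat. prime p \<and> p \<le> m + 1} \<le> 4 ^ (m + 1)"
        using 4 by (intro less) auto
      have "\<Prod>?Q dvd (2 * m + 1 choose m)"
      proof -
        have "[(2 * m + 1 choose m) = 0] (mod (\<Prod>p\<in>?Q. p))"
        proof (rule coprime_cong_prod_nat)
          fix p assume "p \<in> ?Q"
          then have p: "prime p" "m < p" "m + 1 < p" "p \<le> 2 * m + 1" by auto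
          have "p dvd fact (2 * m + 1)" "\<not> p dvd fact m" "\<not> p dvd fact (m + 1)"
            unfolding prime_dvd_fact_iff [OF p(1)] not_le by fact+
          moreover have "fact (2 * m + 1) = fact m * fact (m + 1) * (2 * m + 1 choose m)"
            using binomial_fact_lemma [of m "2 * m + 1"] by simp
          ultimately have "p dvd (2 * m + 1 choose m)"
            using p(1) by (metis prime_dvd_mult_iff)
          then show "[(2 * m + 1 choose m) = 0] (mod p)" by (simp add: cong_0_iff)
        qed (auto intro: primes_coprime)
        then show ?thesis by (simp add: cong_0_iff)
      qed
      then have "\<Prod>?Q \<le> (2 * m + 1 choose m)"
        by (intro dvd_imp_le) auto
      also have "\<dots> \<le> 4 ^ m"
      proof -
        \<comment> \<open>The two middle coefficients of row \<open>2 * m + 1\<close> are equal and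
          add up to at most the row sum \<open>2 * 4 ^ m\<close>.\<close>
        have "(2 * m + 1 choose m) + (2 * m + 1 choose (m + 1)) = (\<Sum>k\<in>{m, m + 1}. 2 * m + 1 choose k)"
          by simp
        also have "\<dots> \<le> (\<Sum>k\<le>2 * m + 1. 2 * m + 1 choose k)"
          by (intro sum_mono2) auto
        also have "\<dots> = 2 * 4 ^ m"
          by (simp add: choose_row_sum [of "2 * m + 1", simplified] power_mult)
        finally show ?thesis
          using binomial_symmetric [of m "2 * m + 1"] by simp
      qed
      finally show "\<Prod>?Q \<le> 4 ^ m" .
    qed auto
    also have "\<dots> = 4 ^ n" using 4 by (simp add: power_add mult_2)
    finally show ?thesis .
  qed
qed

text \<open>Every prime power in the binomial coefficient is at most \<open>2 * n\<close>, and
  primes above \<open>sqrt (2 * n)\<close> occur at most once. Using the primorial bound only up to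
  \<open>n div 2\<close> costs \<open>4 ^ (n div 2)\<close>, roughly the square root of the
  coefficient. The primes in \<open>(n/2, 2 * n]\<close> must supply the rest.\<close>

lemma central_binomial_le_primes:
  fixes n :: nat
  assumes "0 < n"
  shows "(2 * n choose n) \<le> (2 * n) ^ card {p. prime p \<and> p ^ 2 \<le> 2 * n} * 4 ^ (n div 2)
      * (2 * n) ^ card {p. prime p \<and> n < 2 * p \<and> p \<le> 2 * n}"
proof -
  let ?c = "2 * n choose n" and ?P = "{p :: nat. prime p \<and> p \<le> 2 * n}"
  have fin: "finite ?P"
    by (rule finite_subset [of _ "{..2 * n}"]) auto
  have le: "p \<le> 2 * n" if "prime p" "p ^ 2 \<le> 2 * n" for p
    using that by (metis le_trans power2_nat_le_imp_le)
  have "prime_factors ?c \<subseteq> ?P"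
  proof
    fix p assume "p \<in> prime_factors ?c"
    then have p: "prime p" "p dvd ?c" by auto
    then have "p dvd fact (2 * n)"
      using binomial_fact_lemma [of n "2 * n"] by (metis dvd_mult le_add2 mult_2)
    with p show "p \<in> ?P" by (simp add: prime_dvd_fact_iff)
  qed
  have "?c = (\<Prod>p\<in>prime_factors ?c. p ^ multiplicity p ?c)"
    using prod_prime_factors [of ?c] by simp
  also have "\<dots> = (\<Prod>p\<in>?P. p ^ multiplicity p ?c)"
    using fin \<open>prime_factors ?c \<subseteq> ?P\<close>
    by (intro prod.mono_neutral_left) (auto simp: prime_factors_multiplicity)
  \<comment> \<open>The ranges of the three factors may overlap. This is harmless, because each
    factor is at least 1 and one of them already dominates the prime power.\<close>
  also have "\<dots> \<le> (\<Prod>p\<in>?P. (if p ^ 2 \<le> 2 * n then 2 * n else 1) * (if p \<le> n div 2 then p else 1)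
      * (if n < 2 * p then 2 * n else 1))"
  proof (intro prod_mono conjI)
    fix p assume "p \<in> ?P"
    then have p: "prime p" by simp
    note b = power_multiplicity_binomial_le [OF p, of n "2 * n"]
    have small: "p ^ multiplicity p ?c \<le> p" if "2 * n < p ^ 2"
    proof -
      have "multiplicity p ?c < 2"
      proof (rule ccontr)
        assume "\<not> multiplicity p ?c < 2"
        then have "p ^ 2 \<le> p ^ multiplicity p ?c"
          using prime_ge_1_nat [OF p] by (intro power_increasing) auto
        with b assms that show False by simp
      qed
      then have "p ^ multiplicity p ?c \<le> p ^ 1"
        using prime_ge_1_nat [OF p] by (intro power_increasing) auto
      then show ?thesis by simp
    qed
    have p0: "0 < p" using p prime_gt_0_nat by blast
    have n2: "1 \<le> 2 * n" using assms by simp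
    show "p ^ multiplicity p ?c \<le> (if p ^ 2 \<le> 2 * n then 2 * n else 1)
      * (if p \<le> n div 2 then p else 1) * (if n < 2 * p then 2 * n else 1)"
    proof (cases "n < 2 * p")
      case True
      then have "p ^ multiplicity p ?c \<le> 1 * 1 * (2 * n)" using b assms by simp
      also have "\<dots> \<le> (if p ^ 2 \<le> 2 * n then 2 * n else 1)
        * (if p \<le> n div 2 then p else 1) * (if n < 2 * p then 2 * n else 1)"
        using True p0 n2 by (intro mult_mono) auto
      finally show ?thesis .
    next
      case False
      then have "p \<le> n div 2" by simp
      show ?thesis
      proof (cases "p ^ 2 \<le> 2 * n")
        case True
        have "p ^ multiplicity p ?c \<le> 2 * n * 1 * 1" using b assms by simp
        also have "\<dots> \<le> (if p ^ 2 \<le> 2 * n then 2 * n else 1)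
          * (if p \<le> n div 2 then p else 1) * (if n < 2 * p then 2 * n else 1)"
          using True p0 n2 by (intro mult_mono) auto
        finally show ?thesis .
      next
        case False
        then show ?thesis using small \<open>p \<le> n div 2\<close> \<open>\<not> n < 2 * p\<close> by simp
      qed
    qed
  qed simp
  also have "\<dots> = (\<Prod>p\<in>{p\<in>?P. p ^ 2 \<le> 2 * n}. 2 * n) * \<Prod>{p\<in>?P. p \<le> n div 2}
      * (\<Prod>p\<in>{p\<in>?P. n < 2 * p}. 2 * n)"
    by (subst prod.distrib, subst prod.distrib) (simp only: prod.inter_filter [OF fin])
  also have "{p\<in>?P. p ^ 2 \<le> 2 * n} = {p. prime p \<and> p ^ 2 \<le> 2 * n}"
    using le by auto
  also have "{p\<in>?P. p \<le> n div 2} = {p. prime p \<and> p \<le> n div 2}"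
    by auto
  also have "{p\<in>?P. n < 2 * p} = {p. prime p \<and> n < 2 * p \<and> p \<le> 2 * n}"
    by auto
  also have "(\<Prod>p\<in>{p. prime p \<and> p ^ 2 \<le> 2 * n}. 2 * n) * \<Prod>{p. prime p \<and> p \<le> n div 2}
      * (\<Prod>p\<in>{p. prime p \<and> n < 2 * p \<and> p \<le> 2 * n}. 2 * n)
     \<le> (2 * n) ^ card {p. prime p \<and> p ^ 2 \<le> 2 * n} * 4 ^ (n div 2)
      * (2 * n) ^ card {p. prime p \<and> n < 2 * p \<and> p \<le> 2 * n}"
    unfolding prod_constant by (intro mult_mono primorial_le) auto
  finally show ?thesis .
qed

text \<open>Take logarithms in the preceding bound and compare with the lower bound
  \<open>4 ^ n / (2 * n)\<close> for the binomial coefficient. Primes with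
  \<open>p ^ 2 \<le> 2 * n\<close> are counted trivially by \<open>sqrt (2 * n)\<close>, and the
  summand 1 absorbs the logarithm of the denominator \<open>2 * n\<close>.\<close>

lemma card_primes_between_ge:
  fixes n :: nat
  assumes "0 < n"
  shows "real n / 2 * ln 4 \<le>
    (real (card {p. prime p \<and> n < 2 * p \<and> p \<le> 2 * n}) + sqrt (2 * real n) + 1) * ln (2 * real n)"
proof -
  let ?k = "card {p. prime p \<and> n < 2 * p \<and> p \<le> 2 * n}"
  let ?s = "card {p. prime p \<and> p ^ 2 \<le> 2 * n}"
  have n: "0 \<le> ln (2 * real n)" using assms by simp
  have "?s \<le> card {1..nat \<lfloor>sqrt (2 * real n)\<rfloor>}"
  proof (intro card_mono)
    show "{p. prime p \<and> p ^ 2 \<le> 2 * n} \<subseteq> {1..nat \<lfloor>sqrt (2 * real n)\<rfloor>}"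
    proof safe
      fix p :: nat assume p: "prime p" "p ^ 2 \<le> 2 * n"
      have "real (p ^ 2) \<le> real (2 * n)" using p by (intro of_nat_mono)
      then have "real p \<le> sqrt (2 * real n)" by (intro real_le_rsqrt) simp
      then show "p \<in> {1..nat \<lfloor>sqrt (2 * real n)\<rfloor>}"
        using prime_ge_1_nat [OF p(1)] by (simp add: le_nat_floor)
    qed
  qed simp
  also have "\<dots> = nat \<lfloor>sqrt (2 * real n)\<rfloor>" by simp
  finally have s: "real ?s \<le> sqrt (2 * real n)"
    using of_nat_floor [of "sqrt (2 * real n)"] by (meson of_nat_mono order_trans real_sqrt_ge_zero mult_nonneg_nonneg of_nat_0_le_iff zero_le_numeral)
  have d: "real (n div 2) \<le> real n / 2" by linarith
  have "real n * ln 4 - ln (2 * real n) = ln (4 ^ n / (2 * real n))"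
    using assms by (simp add: ln_div ln_realpow)
  also have "\<dots> \<le> ln (real (2 * n choose n))"
    using central_binomial_lower_bound [OF assms] assms by (subst ln_le_cancel_iff) auto
  also have "\<dots> \<le> ln (real ((2 * n) ^ ?s * 4 ^ (n div 2) * (2 * n) ^ ?k))"
    using central_binomial_le_primes [OF assms] assms
    by (subst ln_le_cancel_iff) (auto simp del: of_nat_mult of_nat_power)
  also have "\<dots> = real ?s * ln (2 * real n) + real (n div 2) * ln 4 + real ?k * ln (2 * real n)"
  proof -
    have "ln (N ^ a * 4 ^ b * N ^ c) = real a * ln N + real b * ln 4 + real c * ln N"
      if "0 < N" for N :: real and a b c :: nat
      using that by (simp add: ln_mult ln_realpow)
    from this [of "2 * real n"] show ?thesis using assms by simp
  qed
  also have "\<dots> \<le> sqrt (2 * real n) * ln (2 * real n) + real n / 2 * ln 4 + real ?k * ln (2 * real n)"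
    using s d n by (intro add_mono mult_right_mono) auto
  finally show ?thesis by (simp add: algebra_simps)
qed

lemma eventually_card_primes_ge:
  "eventually (\<lambda>y::real. y / ln y / 2 \<le> real (card {p. prime p \<and> y < real p \<and> real p \<le> 5 * y})) at_top"
proof -
  have "1 \<le> ln (4 :: real)"
    using exp_le by (simp add: ln_ge_iff)
  \<comment> \<open>Halving the main term leaves room for replacing \<open>ln y\<close> by
    \<open>ln (5 * y)\<close> and for subtracting the square root.\<close>
  have "eventually (\<lambda>y::real. y / ln y / 2 \<le> y / ln (5 * y) - sqrt (5 * y) - 1) at_top"
    by real_asymp
  then show ?thesis
    using eventually_ge_at_top [of 2]
  proof eventually_elim
    case (elim y)
    \<comment> \<open>This choice places \<open>(n/2, 2 * n]\<close> inside
      \<open>(y, 5 * y]\<close>. The ratio 5 instead of 4 absorbs the rounding, since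
      \<open>4 * y + 2 \<le> 5 * y\<close> for \<open>y \<ge> 2\<close>.\<close>
    define n where "n = nat \<lceil>2 * y\<rceil>"
    have n: "2 * y \<le> real n" "2 * real n \<le> 5 * y" "0 < n"
      using elim(2) unfolding n_def by linarith+
    let ?k = "card {p. prime p \<and> n < 2 * p \<and> p \<le> 2 * n}"
    have "?k \<le> card {p. prime p \<and> y < real p \<and> real p \<le> 5 * y}"
    proof (intro card_mono)
      show "finite {p. prime p \<and> y < real p \<and> real p \<le> 5 * y}"
        by (rule finite_subset [of _ "{..nat \<lfloor>5 * y\<rfloor>}"]) (auto simp: le_nat_floor)
      show "{p. prime p \<and> n < 2 * p \<and> p \<le> 2 * n} \<subseteq> {p. prime p \<and> y < real p \<and> real p \<le> 5 * y}"
      proof safe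
        fix p :: nat assume p: "n < 2 * p" "p \<le> 2 * n"
        have "real n < real (2 * p)" "real p \<le> real (2 * n)"
          using p by (simp_all only: of_nat_less_iff of_nat_le_iff)
        then show "y < real p" "real p \<le> 5 * y" using n by simp_all
      qed
    qed
    moreover have "y / ln (5 * y) - sqrt (5 * y) - 1 \<le> real ?k"
    proof -
      have l: "0 < ln (2 * real n)" "ln (2 * real n) \<le> ln (5 * y)"
        using n elim(2) by auto
      have "y * 1 \<le> real n / 2 * ln 4"
        using n \<open>1 \<le> ln 4\<close> by (intro mult_mono) auto
      also have "\<dots> \<le> (real ?k + sqrt (2 * real n) + 1) * ln (2 * real n)"
        by (rule card_primes_between_ge [OF n(3)])
      also have "\<dots> \<le> (real ?k + sqrt (5 * y) + 1) * ln (5 * y)"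
        using l n elim(2) by (intro mult_mono add_mono) auto
      finally show ?thesis
        using l by (simp add: field_simps)
    qed
    ultimately show ?case using elim(1) by linarith
  qed
qed

subsection \<open>Partial Euler products for \<open>\<zeta>(2)\<close>\<close>

text \<open>For a set \<open>P\<close> of primes this indexes the Dirichlet series of
  \<open>\<zeta>\<close> with the Euler factors at \<open>P\<close> removed.\<close>

definition unsifted :: "nat set \<Rightarrow> nat set" where
  "unsifted P = {n. \<forall>p\<in>P. \<not> p dvd n}"

text \<open>The summand at \<open>n = 0\<close> is \<open>1 / 0 = 0\<close>, so it does not matter that \<open>0 \<in> unsifted {}\<close>.\<close>

lemma has_sum_inverse_squares: "((\<lambda>n::nat. 1 / real n ^ 2) has_sum (pi ^ 2 / 6)) UNIV"
proof -
  have "(\<lambda>n. 1 / real (Suc n) ^ 2) sums (pi ^ 2 / 6)"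
    using inverse_squares_sums by (simp add: add.commute)
  then have "(\<lambda>n. 1 / real n ^ 2) sums (pi ^ 2 / 6)"
    by (subst (asm) sums_Suc_iff) simp
  then show ?thesis
    by (intro norm_summable_imp_has_sum) (auto simp: sums_iff)
qed

lemma summable_on_inverse_squares: "(\<lambda>n::nat. 1 / real n ^ 2) summable_on A"
  using has_sum_inverse_squares summable_on_subset_banach
  by (metis has_sum_imp_summable subset_UNIV)

text \<open>For a prime \<open>p\<close> outside \<open>P\<close>, the multiples of \<open>p\<close>
  in \<open>unsifted P\<close> are exactly \<open>p\<close> times the elements of
  \<open>unsifted P\<close>. Discarding them therefore multiplies the sum by
  \<open>1 - 1 / p ^ 2\<close>.\<close>

lemma infsum_unsifted:
  assumes "finite P" "\<And>p. p \<in> P \<Longrightarrow> prime p"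
  shows "(\<Sum>\<^sub>\<infinity>n\<in>unsifted P. 1 / real n ^ 2) = pi ^ 2 / 6 * (\<Prod>p\<in>P. 1 - 1 / real p ^ 2)"
  using assms
proof (induction P rule: finite_induct)
  case empty
  show ?case
    using infsumI [OF has_sum_inverse_squares] by (simp add: unsifted_def)
next
  case (insert p P)
  have p: "prime p" using insert by simp
  have "q dvd p * n \<longleftrightarrow> q dvd n" if "q \<in> P" for q n
    using that insert by (metis insert_iff p prime_dvd_mult_iff primes_dvd_imp_eq)
  then have "p * n \<in> unsifted P \<longleftrightarrow> n \<in> unsifted P" for n
    by (auto simp: unsifted_def)
  then have img: "(*) p ` unsifted P = {n \<in> unsifted P. p dvd n}"
    by (auto elim!: dvdE)
  have "unsifted P = unsifted (insert p P) \<union> (*) p ` unsifted P"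
    unfolding img by (auto simp: unsifted_def)
  then have "(\<Sum>\<^sub>\<infinity>n\<in>unsifted P. 1 / real n ^ 2)
      = (\<Sum>\<^sub>\<infinity>n\<in>unsifted (insert p P) \<union> (*) p ` unsifted P. 1 / real n ^ 2)"
    by (rule arg_cong)
  also have "\<dots> = (\<Sum>\<^sub>\<infinity>n\<in>unsifted (insert p P). 1 / real n ^ 2)
      + (\<Sum>\<^sub>\<infinity>n\<in>(*) p ` unsifted P. 1 / real n ^ 2)"
    by (intro infsum_Un_disjoint summable_on_inverse_squares) (auto simp: unsifted_def)
  also have "(\<Sum>\<^sub>\<infinity>n\<in>(*) p ` unsifted P. 1 / real n ^ 2)
      = (\<Sum>\<^sub>\<infinity>n\<in>unsifted P. 1 / real p ^ 2 * (1 / real n ^ 2))"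
    using p by (subst infsum_reindex) (auto simp: inj_on_def o_def power_mult_distrib)
  also have "\<dots> = 1 / real p ^ 2 * (\<Sum>\<^sub>\<infinity>n\<in>unsifted P. 1 / real n ^ 2)"
    by (rule infsum_cmult_right')
  finally have "(\<Sum>\<^sub>\<infinity>n\<in>unsifted (insert p P). 1 / real n ^ 2)
      = (\<Sum>\<^sub>\<infinity>n\<in>unsifted P. 1 / real n ^ 2) * (1 - 1 / real p ^ 2)"
    by (simp add: algebra_simps)
  then show ?case
    using insert by (simp add: mult_ac)
qed

text \<open>The term \<open>n = 1\<close> always survives the sieve, so the remaining sum of inverse
  squares is at least 1.\<close>

lemma prod_one_minus_inverse_square_ge:
  assumes "finite P" "\<And>p. p \<in> P \<Longrightarrow> prime p"
  shows "6 / pi ^ 2 \<le> (\<Prod>p\<in>P. 1 - 1 / real p ^ 2)"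
proof -
  have "1 \<in> unsifted P"
    using assms(2) [of 1] by (auto simp: unsifted_def)
  then have "(\<Sum>\<^sub>\<infinity>n\<in>{1 :: nat}. 1 / real n ^ 2) \<le> (\<Sum>\<^sub>\<infinity>n\<in>unsifted P. 1 / real n ^ 2)"
    by (intro infsum_mono_neutral summable_on_inverse_squares) auto
  then show ?thesis
    using infsum_unsifted [OF assms] by (simp add: field_simps)
qed

text \<open>Apart from 0 and 1, every integer without prime factors up to \<open>z\<close> exceeds
  \<open>z\<close>. The sum of \<open>1 / n ^ 2\<close> over \<open>n > z\<close> is at most the
  telescoping sum of \<open>1 / (n - 1) - 1 / n\<close>, which equals \<open>1 / z\<close>.\<close>

lemma prod_one_minus_inverse_square_le:
  assumes "0 < z"
  shows "(\<Prod>p | prime p \<and> p \<le> z. 1 - 1 / real p ^ 2) \<le> 6 / pi ^ 2 * (1 + 1 / real z)"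
proof -
  let ?P = "{p. prime p \<and> p \<le> z}"
  have tail: "(\<lambda>n. 1 / real (n + z) - 1 / real (Suc n + z)) sums (1 / real z)"
  proof -
    have "(\<lambda>n. 1 / real (n + z)) \<longlonglongrightarrow> 0" by real_asymp
    from telescope_sums' [OF this] show ?thesis by simp
  qed
  have tail': "((\<lambda>n. 1 / real (n + z) - 1 / real (Suc n + z)) has_sum (1 / real z)) UNIV"
  proof (intro norm_summable_imp_has_sum tail)
    have "norm (1 / real (n + z) - 1 / real (Suc n + z)) = 1 / real (n + z) - 1 / real (Suc n + z)" for n
      using assms by (simp add: frac_le)
    then show "summable (\<lambda>n. norm (1 / real (n + z) - 1 / real (Suc n + z)))"
      using sums_summable [OF tail] by simp
  qed
  \<comment> \<open>Zero survives only when there is no prime up to \<open>z\<close>, that is for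
    \<open>z = 1\<close>; its summand is 0.\<close>
  have "unsifted ?P \<subseteq> {0, 1} \<union> (\<lambda>n. Suc n + z) ` UNIV"
  proof
    fix n assume n: "n \<in> unsifted ?P"
    show "n \<in> {0, 1} \<union> (\<lambda>n. Suc n + z) ` UNIV"
    proof (cases "n \<le> 1")
      case False
      then obtain p where p: "prime p" "p dvd n"
        using prime_factor_nat [of n] by auto
      with n have "z < p" unfolding unsifted_def by (metis (mono_tags, lifting) mem_Collect_eq not_le)
      also have "p \<le> n" using p False by (intro dvd_imp_le) auto
      finally have "n = Suc (n - Suc z) + z" by simp
      then show ?thesis by blast
    qed auto
  qed
  then have "(\<Sum>\<^sub>\<infinity>n\<in>unsifted ?P. 1 / real n ^ 2)
      \<le> (\<Sum>\<^sub>\<infinity>n\<in>{0, 1} \<union> (\<lambda>n. Suc n + z) ` UNIV. 1 / real n ^ 2)"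
    by (intro infsum_mono_neutral summable_on_inverse_squares) auto
  also have "\<dots> = (\<Sum>\<^sub>\<infinity>n\<in>{0, 1 :: nat}. 1 / real n ^ 2)
      + (\<Sum>\<^sub>\<infinity>n\<in>(\<lambda>n. Suc n + z) ` UNIV. 1 / real n ^ 2)"
    using assms by (intro infsum_Un_disjoint summable_on_inverse_squares) auto
  also have "(\<Sum>\<^sub>\<infinity>n\<in>{0, 1 :: nat}. 1 / real n ^ 2) = 1"
    by simp
  also have "(\<Sum>\<^sub>\<infinity>n\<in>(\<lambda>n. Suc n + z) ` UNIV. 1 / real n ^ 2)
      = (\<Sum>\<^sub>\<infinity>n. 1 / real (Suc n + z) ^ 2)"
    by (subst infsum_reindex) (auto simp: inj_on_def o_def)
  also have "\<dots> \<le> (\<Sum>\<^sub>\<infinity>n. 1 / real (n + z) - 1 / real (Suc n + z))"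
  proof (intro infsum_mono)
    have "inj (\<lambda>n. Suc n + z)" by (auto simp: inj_on_def)
    from summable_on_reindex [OF this, of "\<lambda>n. 1 / real n ^ 2"]
    show "(\<lambda>n. 1 / real (Suc n + z) ^ 2) summable_on UNIV"
      using summable_on_inverse_squares by (auto simp: o_def)
    show "(\<lambda>n. 1 / real (n + z) - 1 / real (Suc n + z)) summable_on UNIV"
      using tail' by (rule has_sum_imp_summable)
    show "1 / real (Suc n + z) ^ 2 \<le> 1 / real (n + z) - 1 / real (Suc n + z)" for n
    proof -
      have "1 / real (Suc n + z) ^ 2 \<le> 1 / (real (n + z) * real (Suc n + z))"
        using assms unfolding power2_eq_square by (intro divide_left_mono mult_mono mult_pos_pos) auto
      also have "\<dots> = 1 / real (n + z) - 1 / real (Suc n + z)"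
        using assms by (simp add: field_simps)
      finally show ?thesis .
    qed
  qed
  also have "\<dots> = 1 / real z"
    using infsumI [OF tail'] .
  finally have "(\<Sum>\<^sub>\<infinity>n\<in>unsifted ?P. 1 / real n ^ 2) \<le> 1 + 1 / real z"
    by simp
  then have "pi ^ 2 / 6 * (\<Prod>p\<in>?P. 1 - 1 / real p ^ 2) \<le> 1 + 1 / real z"
    by (subst (asm) infsum_unsifted) (auto intro: finite_subset [of _ "{..z}"])
  then show ?thesis by (simp add: field_simps)
qed

subsection \<open>A quadratic sieve for prime squares\<close>

text \<open>The double sum factors over the elements of \<open>P\<close>: each lies in neither set
  (weight 1), in exactly one of them (weight \<open>s\<close>, in two ways) or in both (weight
  \<open>s ^ 2\<close>). The cases \<open>s = -1\<close> and \<open>s = 1\<close> give the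
  coefficients \<open>-1\<close> and \<open>3\<close>.\<close>

lemma sum_Pow_Pow_prod_Un:
  fixes f :: "'a \<Rightarrow> real"
  assumes "finite P"
  shows "(\<Sum>S\<in>Pow P. \<Sum>T\<in>Pow P. s ^ card S * s ^ card T * (\<Prod>p\<in>S \<union> T. f p))
    = (\<Prod>p\<in>P. 1 + (2 * s + s ^ 2) * f p)"
  using assms
proof (induction P rule: finite_induct)
  case empty
  show ?case by simp
next
  case (insert q P)
  have Pow_insert_sum: "(\<Sum>S\<in>Pow (insert q P). g S) = (\<Sum>S\<in>Pow P. g S + g (insert q S))"
    for g :: "'a set \<Rightarrow> real"
  proof -
    have "inj_on (insert q) (Pow P)" "Pow P \<inter> insert q ` Pow P = {}"
      using insert.hyps by (auto simp: inj_on_def)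
    then show ?thesis
      using insert.hyps by (simp add: Pow_insert sum.union_disjoint sum.reindex sum.distrib)
  qed
  have *: "finite S" "finite T" "q \<notin> S" "q \<notin> T" if "S \<in> Pow P" "T \<in> Pow P" for S T
    using that insert.hyps by (auto intro: finite_subset)
  have "(\<Sum>S\<in>Pow (insert q P). \<Sum>T\<in>Pow (insert q P). s ^ card S * s ^ card T * (\<Prod>p\<in>S \<union> T. f p))
    = (\<Sum>S\<in>Pow P. \<Sum>T\<in>Pow P. (1 + (2 * s + s ^ 2) * f q)
        * (s ^ card S * s ^ card T * (\<Prod>p\<in>S \<union> T. f p)))"
    unfolding Pow_insert_sum sum.distrib [symmetric]
    using * by (intro sum.cong refl) (simp add: algebra_simps power2_eq_square)
  also have "\<dots> = (1 + (2 * s + s ^ 2) * f q) * (\<Prod>p\<in>P. 1 + (2 * s + s ^ 2) * f p)"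
    unfolding sum_distrib_left [symmetric] insert.IH ..
  finally show ?case using insert.hyps by simp
qed

lemma card_cong_bounds:
  fixes a m N :: nat
  assumes "0 < m"
  shows "\<bar>real (card {n\<in>{1..N}. [n = a] (mod m)}) - real N / real m\<bar> \<le> 1"
proof -
  \<comment> \<open>The representative of \<open>a\<close> in \<open>{1..m}\<close> rather than in
    \<open>{0..<m}\<close>, because the interval starts at 1. As \<open>r \<le> m\<close>, the
    subtraction in \<open>N + m - r\<close> below is not truncated.\<close>
  define r where "r = (if m dvd a then m else a mod m)"
  have r: "0 < r" "r \<le> m"
    using assms by (auto simp: r_def mod_greater_zero_iff_not_dvd less_imp_le)
  have "[r = a] (mod m)"
  proof (cases "m dvd a")
    case True
    then have "[m = 0] (mod m)" "[0 = a] (mod m)"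
      by (simp_all add: cong_0_iff cong_sym_eq [of 0])
    then show ?thesis using True cong_trans by (simp add: r_def) blast
  qed (simp add: r_def)
  then have cong: "[n = a] (mod m) \<longleftrightarrow> [n = r] (mod m)" for n
    using cong_sym cong_trans by blast
  have "{n\<in>{1..N}. [n = a] (mod m)} = (\<lambda>j. r + j * m) ` {..<(N + m - r) div m}"
  proof (intro equalityI subsetI)
    fix n assume "n \<in> {n\<in>{1..N}. [n = a] (mod m)}"
    then have n: "0 < n" "n \<le> N" "[n = r] (mod m)" by (auto simp: cong)
    have "r \<le> n"
    proof (rule ccontr)
      assume "\<not> r \<le> n"
      then have "m dvd r - n" "0 < r - n"
        using cong_altdef_nat [of n r m] cong_sym [OF n(3)] by simp_all
      then have "m \<le> r - n" by (rule dvd_imp_le)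
      then show False using r n by simp
    qed
    then obtain j where j: "n = r + j * m"
      using n(3) by (metis cong_le_nat cong_sym_eq add.commute mult.commute)
    have "(j + 1) * m \<le> N + m - r"
      using n r j by (simp add: algebra_simps)
    then have "j < (N + m - r) div m"
      using assms by (simp add: less_eq_div_iff_mult_less_eq Suc_le_eq [symmetric])
    then show "n \<in> (\<lambda>j. r + j * m) ` {..<(N + m - r) div m}" using j by blast
  next
    fix n assume "n \<in> (\<lambda>j. r + j * m) ` {..<(N + m - r) div m}"
    then obtain j where j: "n = r + j * m" "j < (N + m - r) div m" by blast
    then have "(j + 1) * m \<le> N + m - r"
      using assms by (simp add: less_eq_div_iff_mult_less_eq Suc_le_eq [symmetric])
    then have "j * m + m \<le> N + m - r" by (simp add: add_mult_distrib)
    then have "0 < n" "n \<le> N" using r unfolding j(1) by linarith+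
    moreover have "n mod m = r mod m" unfolding j(1) by (rule mod_mult_self1)
    ultimately show "n \<in> {n\<in>{1..N}. [n = a] (mod m)}"
      unfolding cong by (simp add: Cong.cong_def)
  qed
  then have c: "card {n\<in>{1..N}. [n = a] (mod m)} = (N + m - r) div m"
    using assms by (simp add: card_image inj_on_def)
  let ?q = "(N + m - r) div m"
  have "?q * m \<le> N + m - r" "N + m - r < (?q + 1) * m"
    using assms by (simp_all add: div_times_less_eq_dividend dividend_less_div_times)
  then have "?q * m \<le> N + m" "N < (?q + 1) * m"
    using r by linarith+
  then have "real (?q * m) \<le> real (N + m)" "real N < real ((?q + 1) * m)"
    by (simp_all only: of_nat_le_iff of_nat_less_iff)
  then have "real ?q \<le> real N / real m + 1" "real N / real m - 1 \<le> real ?q"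
    using assms by (simp_all add: field_simps)
  then show ?thesis unfolding c by linarith
qed

text \<open>By the Chinese remainder theorem the conditions amount to a single class modulo the
  product of the \<open>p ^ 2\<close>, so the error is at most 1 however many primes are
  involved.\<close>

lemma card_cong_prime_squares_bounds:
  fixes b :: "nat \<Rightarrow> nat"
  assumes "finite U" "\<And>p. p \<in> U \<Longrightarrow> prime p"
  shows "\<bar>real (card {n\<in>{1..N}. \<forall>p\<in>U. [n = b p] (mod p ^ 2)}) - real N * (\<Prod>p\<in>U. 1 / real p ^ 2)\<bar> \<le> 1"
proof -
  have cop: "\<forall>p\<in>U. \<forall>q\<in>U. p \<noteq> q \<longrightarrow> coprime (p ^ 2) (q ^ 2)"
    using assms(2) primes_coprime unfolding coprime_power_left_iff coprime_power_right_iff by blast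
  obtain a where a: "\<forall>p\<in>U. [a = b p] (mod p ^ 2)"
    using chinese_remainder_nat [of U "\<lambda>p. p ^ 2" b, OF assms(1) cop] ..
  have iff: "(\<forall>p\<in>U. [n = b p] (mod p ^ 2)) \<longleftrightarrow> [n = a] (mod (\<Prod>p\<in>U. p ^ 2))" for n
  proof
    assume n: "\<forall>p\<in>U. [n = b p] (mod p ^ 2)"
    show "[n = a] (mod (\<Prod>p\<in>U. p ^ 2))"
    proof (rule coprime_cong_prod_nat)
      fix p assume "p \<in> U"
      have "[n = b p] (mod p ^ 2)" using n \<open>p \<in> U\<close> by (rule bspec)
      also have "[b p = a] (mod p ^ 2)"
        by (rule cong_sym [OF bspec [OF a \<open>p \<in> U\<close>]])
      finally show "[n = a] (mod p ^ 2)" .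
    qed (use cop in blast)
  next
    assume n: "[n = a] (mod (\<Prod>p\<in>U. p ^ 2))"
    show "\<forall>p\<in>U. [n = b p] (mod p ^ 2)"
    proof
      fix p assume "p \<in> U"
      have "p ^ 2 dvd (\<Prod>p\<in>U. p ^ 2)"
        by (rule dvd_prodI [where f = "\<lambda>p. p ^ 2", OF assms(1) \<open>p \<in> U\<close>])
      with n have "[n = a] (mod p ^ 2)"
        by (rule cong_dvd_modulus_nat)
      also have "[a = b p] (mod p ^ 2)"
        using a \<open>p \<in> U\<close> by (rule bspec)
      finally show "[n = b p] (mod p ^ 2)" .
    qed
  qed
  have "0 < (\<Prod>p\<in>U. p ^ 2)"
    using assms(2) prime_gt_0_nat by (intro prod_pos) simp
  from card_cong_bounds [OF this, of N a] show ?thesis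
    unfolding iff by (simp add: prod_dividef)
qed

text \<open>By unique factorisation a set of primes is recovered from its product, and the products
  in question lie in \<open>{1..nat \<lfloor>D\<rfloor>}\<close>.\<close>

lemma card_prime_subsets_prod_le:
  fixes P :: "nat set"
  assumes "finite P" "\<And>p. p \<in> P \<Longrightarrow> prime p" "0 \<le> D"
  shows "real (card {S \<in> Pow P. real (\<Prod>S) \<le> D}) \<le> D"
proof -
  let ?\<D> = "{S \<in> Pow P. real (\<Prod>S) \<le> D}"
  have fin: "finite S" if "S \<in> ?\<D>" for S
    using that assms(1) finite_subset by auto
  have S: "S = prime_factors (\<Prod>S)" if "S \<in> ?\<D>" for S
  proof -
    have "0 \<notin> (\<lambda>p. p) ` S"
      using that assms(2) [of 0] by auto
    then have "prime_factors (\<Prod>S) = (\<Union>p\<in>S. prime_factors p)"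
      using prime_factors_prod [OF fin [OF that], of "\<lambda>p. p"] by (simp add: o_def)
    also have "\<dots> = S"
      using that assms(2) by (auto simp: prime_factorization_prime subset_iff)
    finally show ?thesis ..
  qed
  have "inj_on \<Prod> ?\<D>"
    by (rule inj_on_inverseI [where g = prime_factors], rule S [symmetric])
  moreover have "\<Prod> ` ?\<D> \<subseteq> {1..nat \<lfloor>D\<rfloor>}"
  proof
    fix n assume "n \<in> \<Prod> ` ?\<D>"
    then obtain S where "S \<in> ?\<D>" "n = \<Prod>S" by blast
    moreover from this have "0 < \<Prod>S"
      using assms(2) prime_gt_0_nat by (intro prod_pos) blast
    ultimately show "n \<in> {1..nat \<lfloor>D\<rfloor>}" by (simp add: le_nat_floor Suc_le_eq)
  qed
  ultimately have "card ?\<D> \<le> card {1..nat \<lfloor>D\<rfloor>}"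
    by (intro card_inj_on_le) auto
  then have "real (card ?\<D>) \<le> real (nat \<lfloor>D\<rfloor>)" by simp
  also have "\<dots> \<le> D" using assms(3) by (rule of_nat_floor)
  finally show ?thesis .
qed

text \<open>Expanding the square gives a sum over pairs of sets with product at most
  \<open>D\<close>. Rounding costs at most 1 per pair, hence \<open>D ^ 2\<close> in all. Completing
  the main term to all pairs of subsets of \<open>P\<close> yields the Euler product, and Rankin's
  trick bounds the pairs that were added.\<close>

lemma quadratic_sieve:
  fixes P B :: "nat set" and b :: "nat \<Rightarrow> nat" and D :: real
  assumes P: "finite P" "\<And>p. p \<in> P \<Longrightarrow> prime p"
    and B: "B \<subseteq> {1..N}" "\<And>n p. n \<in> B \<Longrightarrow> p \<in> P \<Longrightarrow> \<not> [n = b p] (mod p ^ 2)"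
    and D: "1 \<le> D"
  shows "real (card B) \<le> real N * (\<Prod>p\<in>P. 1 - 1 / real p ^ 2)
    + real N * D powr (-1/2) * (\<Prod>p\<in>P. 1 + 3 * real p powr (-3/2)) + D ^ 2"
proof -
  define \<D> where "\<D> = {S \<in> Pow P. real (\<Prod>S) \<le> D}"
  define X where "X S = {n\<in>{1..N}. \<forall>p\<in>S. [n = b p] (mod p ^ 2)}" for S
  txt \<open>A squarefree \<open>d\<close> with all prime factors in \<open>P\<close> is encoded as the set \<open>S\<close> of these
    factors, so that \<open>\<mu> d = (-1) ^ card S\<close>.\<close>
  define w where "w S T = (-1 :: real) ^ card S * (-1) ^ card T" for S T :: "nat set"
  define g where "g S T = (\<Prod>p\<in>S \<union> T. 1 / real p ^ 2)" for S T :: "nat set"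
  have w: "\<bar>w S T\<bar> = 1" for S T
    by (simp add: w_def abs_mult power_abs)
  have sub: "finite S" "\<And>p. p \<in> S \<Longrightarrow> prime p" "\<And>p. p \<in> S \<Longrightarrow> 1 \<le> p" if "S \<subseteq> P" for S
  proof -
    show "finite S" using that P(1) by (rule finite_subset)
    show "prime p" if "p \<in> S" for p using \<open>S \<subseteq> P\<close> that P(2) by blast
    then show "1 \<le> p" if "p \<in> S" for p using that prime_ge_1_nat by blast
  qed
  have fin: "finite \<D>" using P by (simp add: \<D>_def)
  have cardD: "real (card \<D>) \<le> D"
    using card_prime_subsets_prod_le [OF P, of D] D by (simp add: \<D>_def)

  have "real (card B) = (\<Sum>n\<in>B. (\<Sum>S\<in>\<D>. (-1) ^ card S * of_bool (n \<in> X S)) ^ 2)"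
  proof -
    have "(\<Sum>S\<in>\<D>. (-1) ^ card S * of_bool (n \<in> X S)) = (1 :: real)" if n: "n \<in> B" for n
    proof -
      have "(\<Sum>S\<in>\<D>. (-1) ^ card S * of_bool (n \<in> X S))
          = (\<Sum>S\<in>{{}}. (-1) ^ card S * of_bool (n \<in> X S) :: real)"
      \<comment> \<open>Since \<open>n\<close> avoids \<open>b p\<close> for every \<open>p\<close>
        in \<open>P\<close>, only the empty set contributes.\<close>
      proof (intro sum.mono_neutral_right fin ballI)
        show "{{}} \<subseteq> \<D>" using D by (simp add: \<D>_def)
        fix S assume "S \<in> \<D> - {{}}"
        then obtain p where "p \<in> S" "p \<in> P" by (auto simp: \<D>_def)
        then have "n \<notin> X S" using B(2) [OF n] by (auto simp: X_def)
        then show "(-1) ^ card S * of_bool (n \<in> X S) = (0 :: real)" by simp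
      qed
      also have "\<dots> = 1" using n B by (auto simp: X_def)
      finally show ?thesis .
    qed
    then show ?thesis by simp
  qed
  \<comment> \<open>Squares are nonnegative, so the sum may be extended from \<open>B\<close> to the
    whole interval.\<close>
  also have "\<dots> \<le> (\<Sum>n\<in>{1..N}. (\<Sum>S\<in>\<D>. (-1) ^ card S * of_bool (n \<in> X S)) ^ 2)"
    using B by (intro sum_mono2) auto
  also have "\<dots> = (\<Sum>n\<in>{1..N}. \<Sum>S\<in>\<D>. \<Sum>T\<in>\<D>. w S T * of_bool (n \<in> X (S \<union> T)))"
    unfolding power2_eq_square sum_product
    by (intro sum.cong refl) (auto simp: w_def X_def)
  also have "\<dots> = (\<Sum>S\<in>\<D>. \<Sum>T\<in>\<D>. \<Sum>n\<in>{1..N}. w S T * of_bool (n \<in> X (S \<union> T)))"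
    by (subst sum.swap, intro sum.cong refl, rule sum.swap)
  also have "\<dots> = (\<Sum>S\<in>\<D>. \<Sum>T\<in>\<D>. w S T * real (card (X (S \<union> T))))"
  proof (intro sum.cong refl)
    fix S T
    have "(\<Sum>n\<in>{1..N}. of_bool (n \<in> X (S \<union> T)) :: real) = real (card (X (S \<union> T)))"
      by (simp add: X_def of_bool_def sum.If_cases Int_def conj_ac)
    then show "(\<Sum>n\<in>{1..N}. w S T * of_bool (n \<in> X (S \<union> T))) = w S T * real (card (X (S \<union> T)))"
      by (simp add: sum_distrib_left [symmetric])
  qed
  also have "\<dots> \<le> (\<Sum>S\<in>\<D>. \<Sum>T\<in>\<D>. real N * (w S T * g S T) + 1)"
  proof (intro sum_mono)
    fix S T assume "S \<in> \<D>" "T \<in> \<D>"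
    then have "S \<union> T \<subseteq> P" by (auto simp: \<D>_def)
    then have "\<bar>real (card (X (S \<union> T))) - real N * g S T\<bar> \<le> 1"
      unfolding X_def g_def by (intro card_cong_prime_squares_bounds sub)
    then have "\<bar>w S T * (real (card (X (S \<union> T))) - real N * g S T)\<bar> \<le> 1"
      by (simp add: abs_mult w)
    then show "w S T * real (card (X (S \<union> T))) \<le> real N * (w S T * g S T) + 1"
      by (simp add: algebra_simps)
  qed
  also have "\<dots> = real N * (\<Sum>S\<in>\<D>. \<Sum>T\<in>\<D>. w S T * g S T) + real (card \<D>) ^ 2"
    by (simp add: sum.distrib sum_distrib_left power2_eq_square)
  finally have card_le: "real (card B)
      \<le> real N * (\<Sum>S\<in>\<D>. \<Sum>T\<in>\<D>. w S T * g S T) + real (card \<D>) ^ 2" .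
  have "(\<Sum>S\<in>\<D>. \<Sum>T\<in>\<D>. w S T * g S T)
      \<le> (\<Prod>p\<in>P. 1 - 1 / real p ^ 2) + D powr (-1/2) * (\<Prod>p\<in>P. 1 + 3 * real p powr (-3/2))"
  proof -
    let ?A = "Pow P \<times> Pow P"
    have finA: "finite ?A" using P by simp
    have DA: "\<D> \<times> \<D> \<subseteq> ?A" by (auto simp: \<D>_def)
    have tail: "\<bar>w S T * g S T\<bar> \<le> D powr (-1/2) * (\<Prod>p\<in>S \<union> T. real p powr (-3/2))"
      if ST: "(S, T) \<in> ?A - \<D> \<times> \<D>" for S T
    proof -
      let ?m = "\<Prod>p\<in>S \<union> T. p"
      have U: "S \<union> T \<subseteq> P" using ST by auto
      have m: "\<Prod>S dvd ?m" "\<Prod>T dvd ?m" "0 < ?m"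
      proof -
        show "\<Prod>S dvd ?m" "\<Prod>T dvd ?m"
          by (intro prod_dvd_prod_subset sub(1) [OF U] Un_upper1 Un_upper2)+
        have "0 < p" if "p \<in> S \<union> T" for p using sub(3) [OF U that] by simp
        then show "0 < ?m" by (rule prod_pos)
      qed
      \<comment> \<open>At least one of \<open>S\<close> and \<open>T\<close> lies outside
        \<open>\<D>\<close>, and the product over the union is a multiple of both products.\<close>
      have "D < real (\<Prod>S) \<or> D < real (\<Prod>T)"
        using ST by (auto simp: \<D>_def)
      moreover have "real (\<Prod>S) \<le> real ?m" "real (\<Prod>T) \<le> real ?m"
        using m by (simp_all only: of_nat_le_iff dvd_imp_le)
      ultimately have "D \<le> real ?m" by linarith
      have "\<bar>w S T * g S T\<bar> = g S T"
        unfolding abs_mult w by (simp add: g_def prod_nonneg)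
      \<comment> \<open>Rankin's trick: of \<open>p powr (-2)\<close> the part
        \<open>p powr (-1/2)\<close> is spent on the saving \<open>D powr (-1/2)\<close>, while the
        remaining exponent \<open>-3/2\<close> still gives a convergent product.\<close>
      also have "\<dots> = (\<Prod>p\<in>S \<union> T. real p powr (-1/2) * real p powr (-3/2))"
        unfolding g_def
      proof (intro prod.cong refl)
        fix p assume "p \<in> S \<union> T"
        then have "1 \<le> p" by (rule sub(3) [OF U])
        then have "0 < real p" by simp
        have "real p powr (-1/2) * real p powr (-3/2) = real p powr ((-1/2) + (-3/2))"
          by (rule powr_add [symmetric])
        also have "(-1/2) + (-3/2) = (-2 :: real)" by simp
        also have "real p powr (-2) = 1 / real p ^ 2"
          using \<open>0 < real p\<close> by (simp only: powr_minus_divide powr_numeral less_imp_le)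
        finally show "1 / real p ^ 2 = real p powr (-1/2) * real p powr (-3/2)" ..
      qed
      also have "\<dots> = real ?m powr (-1/2) * (\<Prod>p\<in>S \<union> T. real p powr (-3/2))"
      proof -
        have "(\<Prod>p\<in>S \<union> T. real p powr (-1/2)) = (\<Prod>p\<in>S \<union> T. real p) powr (-1/2)"
          by (rule prod_powr_distrib [symmetric])
        then show ?thesis by (simp only: prod.distrib of_nat_prod)
      qed
      also have "\<dots> \<le> D powr (-1/2) * (\<Prod>p\<in>S \<union> T. real p powr (-3/2))"
        using \<open>D \<le> real ?m\<close> D by (intro mult_right_mono powr_mono2' prod_nonneg) auto
      finally show ?thesis .
    qed
    have split: "(\<Sum>S\<in>\<D>. \<Sum>T\<in>\<D>. w S T * g S T) = (\<Sum>(S, T)\<in>?A. w S T * g S T)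
        - (\<Sum>(S, T)\<in>?A - \<D> \<times> \<D>. w S T * g S T)"
      using sum_diff [OF finA DA, of "\<lambda>(S, T). w S T * g S T"]
      by (simp add: sum.cartesian_product)
    have main: "(\<Sum>(S, T)\<in>?A. w S T * g S T) = (\<Prod>p\<in>P. 1 - 1 / real p ^ 2)"
      using sum_Pow_Pow_prod_Un [OF P(1), of "-1" "\<lambda>p. 1 / real p ^ 2"]
      by (simp add: sum.cartesian_product [symmetric] w_def g_def)
    have "- (\<Sum>(S, T)\<in>?A - \<D> \<times> \<D>. w S T * g S T)
        \<le> (\<Sum>(S, T)\<in>?A - \<D> \<times> \<D>. D powr (-1/2) * (\<Prod>p\<in>S \<union> T. real p powr (-3/2)))"
      unfolding sum_negf [symmetric]
    proof (intro sum_mono)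
      fix x assume "x \<in> ?A - \<D> \<times> \<D>"
      then show "- (case x of (S, T) \<Rightarrow> w S T * g S T)
          \<le> (case x of (S, T) \<Rightarrow> D powr (-1/2) * (\<Prod>p\<in>S \<union> T. real p powr (-3/2)))"
        using tail [of "fst x" "snd x"] by (simp add: case_prod_beta)
    qed
    also have "\<dots> \<le> (\<Sum>(S, T)\<in>?A. D powr (-1/2) * (\<Prod>p\<in>S \<union> T. real p powr (-3/2)))"
      using finA by (intro sum_mono2) (auto intro!: mult_nonneg_nonneg prod_nonneg)
    also have "\<dots> = D powr (-1/2) * (\<Prod>p\<in>P. 1 + 3 * real p powr (-3/2))"
      using sum_Pow_Pow_prod_Un [OF P(1), of 1 "\<lambda>p. real p powr (-3/2)"]
      by (simp add: sum.cartesian_product [symmetric] sum_distrib_left [symmetric])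
    finally show ?thesis using split main by linarith
  qed
  then have "real N * (\<Sum>S\<in>\<D>. \<Sum>T\<in>\<D>. w S T * g S T)
      \<le> real N * ((\<Prod>p\<in>P. 1 - 1 / real p ^ 2)
        + D powr (-1/2) * (\<Prod>p\<in>P. 1 + 3 * real p powr (-3/2)))"
    by (intro mult_left_mono) auto
  moreover have "real (card \<D>) ^ 2 \<le> D ^ 2"
    using cardD by (intro power_mono) auto
  ultimately show ?thesis
    using card_le unfolding distrib_left mult.assoc by linarith
qed

subsection \<open>Bounds for \<open>max_admissible\<close>\<close>

lemma card_le_max_admissible: "admissible B \<Longrightarrow> card (B \<inter> initial x) \<le> max_admissible x"
  unfolding max_admissible_def using max_admissible_wf(1) by (intro Max_ge) auto

lemma max_admissible_attained:
  obtains B where "admissible B" "card (B \<inter> initial x) = max_admissible x"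
proof -
  have "max_admissible x \<in> {card (B \<inter> initial x) | B. admissible B}"
    unfolding max_admissible_def by (rule Max_in [OF max_admissible_wf])
  then obtain B where "max_admissible x = card (B \<inter> initial x)" "admissible B"
    by blast
  then show ?thesis by (intro that [of B]) simp_all
qed

lemma initial_eq: "initial x = {1..nat \<lfloor>x\<rfloor>}"
proof (intro equalityI subsetI)
  fix n assume "n \<in> {1..nat \<lfloor>x\<rfloor>}"
  then have "1 \<le> n" "int n \<le> \<lfloor>x\<rfloor>" by auto
  then show "n \<in> initial x"
    unfolding initial_def by (simp add: le_floor_iff)
qed (auto simp: initial_def le_nat_floor)

section \<open>Lower bound by greedy sieving\<close>

text \<open>By the pigeonhole principle some class modulo \<open>m p\<close> contains at most a
  fraction \<open>1 / m p\<close> of the current set. Deleting it preserves the classes already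
  avoided, as the set only shrinks.\<close>

lemma ex_large_unsifted_set:
  fixes m :: "'a \<Rightarrow> nat"
  assumes "finite P" "finite X" "\<And>p. p \<in> P \<Longrightarrow> 0 < m p"
  shows "\<exists>Y\<subseteq>X. (\<forall>p\<in>P. \<exists>b. \<forall>n\<in>Y. \<not> [n = b] (mod m p))
    \<and> real (card X) * (\<Prod>p\<in>P. 1 - 1 / real (m p)) \<le> real (card Y)"
  using assms(1,3)
proof (induction P rule: finite_induct)
  case empty
  show ?case by auto
next
  case (insert p P)
  then obtain Y where Y: "Y \<subseteq> X" "\<forall>p\<in>P. \<exists>b. \<forall>n\<in>Y. \<not> [n = b] (mod m p)"
    "real (card X) * (\<Prod>p\<in>P. 1 - 1 / real (m p)) \<le> real (card Y)"
    by auto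
  have fin: "finite Y" using Y(1) assms(2) by (rule finite_subset)
  have m: "0 < m p" using insert.prems by simp
  define c where "c b = card {n\<in>Y. n mod m p = b}" for b
  have "\<exists>b<m p. real (m p) * real (c b) \<le> real (card Y)"
  proof (rule ccontr)
    assume "\<not> (\<exists>b<m p. real (m p) * real (c b) \<le> real (card Y))"
    then have "(\<Sum>b<m p. real (card Y)) < (\<Sum>b<m p. real (m p) * real (c b))"
      using m by (intro sum_strict_mono) auto
    moreover have "(\<Sum>b<m p. c b) = card Y"
      unfolding c_def
      using sum.group [of Y "{..<m p}" "\<lambda>n. n mod m p" "\<lambda>_. 1 :: nat"] fin m
      by (simp add: image_subset_iff)
    then have "(\<Sum>b<m p. real (c b)) = real (card Y)"
      by (metis of_nat_sum)
    ultimately show False by (simp add: sum_distrib_left [symmetric])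
  qed
  then obtain b where b: "b < m p" "real (m p) * real (c b) \<le> real (card Y)" by blast
  define Z where "Z = {n\<in>Y. n mod m p \<noteq> b}"
  have "card Z = card Y - c b"
  proof -
    have "Z = Y - {n\<in>Y. n mod m p = b}" by (auto simp: Z_def)
    then show ?thesis using fin by (simp only: c_def) (rule card_Diff_subset, auto)
  qed
  moreover have "c b \<le> card Y"
    unfolding c_def using fin by (intro card_mono) auto
  ultimately have "real (card Z) = real (card Y) - real (c b)" by simp
  moreover have "real (c b) \<le> real (card Y) / real (m p)"
    using b m by (simp add: field_simps)
  ultimately have "real (card Y) * (1 - 1 / real (m p)) \<le> real (card Z)"
    by (simp add: algebra_simps)
  moreover have "real (card X) * (\<Prod>q\<in>P. 1 - 1 / real (m q)) * (1 - 1 / real (m p))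
      \<le> real (card Y) * (1 - 1 / real (m p))"
    using Y(3) m by (intro mult_right_mono) auto
  ultimately have card_Z: "real (card X) * (\<Prod>q\<in>insert p P. 1 - 1 / real (m q)) \<le> real (card Z)"
    using insert.hyps by (simp add: mult_ac)
  have avoid: "\<exists>b. \<forall>n\<in>Z. \<not> [n = b] (mod m q)" if "q \<in> insert p P" for q
  proof (cases "q = p")
    case True
    have "\<forall>n\<in>Z. \<not> [n = b] (mod m p)"
      using b(1) by (simp add: Z_def Cong.cong_def)
    then show ?thesis unfolding True by (rule exI)
  next
    case False
    with that have "q \<in> P" by simp
    with Y(2) have "\<exists>b. \<forall>n\<in>Y. \<not> [n = b] (mod m q)" by (rule bspec)
    then obtain b' where "\<forall>n\<in>Y. \<not> [n = b'] (mod m q)" ..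
    then have "\<forall>n\<in>Z. \<not> [n = b'] (mod m q)" by (simp add: Z_def)
    then show ?thesis by (rule exI)
  qed
  have "Z \<subseteq> Y" by (simp add: Z_def)
  then have "Z \<subseteq> X" using Y(1) by (rule subset_trans)
  show ?case
    by (rule exI [of _ Z], rule conjI, fact, rule conjI, rule ballI, erule avoid, fact)
qed

text \<open>For a prime \<open>p > sqrt x\<close> no positive integer up to \<open>x\<close> is
  divisible by \<open>p ^ 2\<close>, so the class 0 is avoided for free and greedy deletion is
  required only for the smaller primes.\<close>

lemma max_admissible_ge:
  assumes "0 \<le> x"
  shows "real (nat \<lfloor>x\<rfloor>) * (\<Prod>p | prime p \<and> real p \<le> sqrt x. 1 - 1 / real p ^ 2)
    \<le> real (max_admissible x)"
proof -
  let ?P = "{p. prime p \<and> real p \<le> sqrt x}"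
  have P: "finite ?P"
    by (rule finite_subset [of _ "{..nat \<lfloor>sqrt x\<rfloor>}"]) (auto simp: le_nat_floor)
  obtain Y where Y: "Y \<subseteq> initial x" "\<forall>p\<in>?P. \<exists>b. \<forall>n\<in>Y. \<not> [n = b] (mod p ^ 2)"
    "real (card (initial x)) * (\<Prod>p\<in>?P. 1 - 1 / real (p ^ 2)) \<le> real (card Y)"
    using ex_large_unsifted_set [OF P finite_initial, of "\<lambda>p. p ^ 2" x] prime_gt_0_nat by auto
  have "\<exists>b. \<forall>n\<in>Y. \<not> [n = b] (mod p ^ 2)" if "prime p" for p
  proof (cases "p \<in> ?P")
    case True
    then show ?thesis using Y(2) by blast
  next
    case False
    then have "sqrt x < real p" using that by auto
    then have "sqrt x ^ 2 < real p ^ 2"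
      using assms by (intro power_strict_mono) auto
    then have x: "x < real (p ^ 2)" using assms by simp
    have "\<not> [n = 0] (mod p ^ 2)" if "n \<in> Y" for n
    proof
      assume "[n = 0] (mod p ^ 2)"
      moreover have n: "0 < n" "real n \<le> x" using that Y(1) by (auto simp: initial_def)
      ultimately have "p ^ 2 \<le> n" by (auto simp: cong_0_iff intro: dvd_imp_le)
      then have "real (p ^ 2) \<le> real n" by (rule of_nat_mono)
      then show False using n x by linarith
    qed
    then show ?thesis by blast
  qed
  moreover have "Y \<subseteq> {0<..}" using Y(1) by (auto simp: initial_def)
  ultimately have "admissible Y" by (simp add: admissible_def)
  then have "card Y \<le> max_admissible x"
    using card_le_max_admissible [of Y x] Y(1) by (simp add: Int_absorb2)
  then have "real (card Y) \<le> real (max_admissible x)" by simp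
  then show ?thesis
    using Y(3) by (simp add: initial_eq)
qed

text \<open>The gain over \<open>6 / pi ^ 2 * x\<close> comes from the \<open>k\<close> primes in
  \<open>(sqrt x, 5 * sqrt x]\<close>, whose Euler factors are absent from the greedy bound. Each is
  worth a factor of at least \<open>1 + 1 / (25 * x)\<close>, and Bernoulli's inequality turns these
  into \<open>1 + k / (25 * x)\<close>.\<close>

lemma max_admissible_lower_bound:
  "eventually (\<lambda>x::real. \<bar>sqrt x / ln x\<bar>
     \<le> (100 * pi ^ 2 / 6) * (real (max_admissible x) - 6 / pi ^ 2 * x)) at_top"
proof -
  have "eventually (\<lambda>x. sqrt x / ln (sqrt x) / 2
      \<le> real (card {p. prime p \<and> sqrt x < real p \<and> real p \<le> 5 * sqrt x})) at_top"
    using eventually_compose_filterlim [OF eventually_card_primes_ge sqrt_at_top] .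
  \<comment> \<open>This forces \<open>k \<ge> 100\<close>, so that \<open>k / 100\<close> pays for
    the loss of 1 in passing from \<open>x\<close> to its floor.\<close>
  moreover have "eventually (\<lambda>x::real. 100 \<le> sqrt x / ln x) at_top"
    by real_asymp
  ultimately show ?thesis
    using eventually_ge_at_top [of 2]
  proof eventually_elim
    case (elim x)
    let ?P = "{p. prime p \<and> real p \<le> sqrt x}"
    let ?Q = "{p. prime p \<and> sqrt x < real p \<and> real p \<le> 5 * sqrt x}"
    define k where "k = card ?Q"
    define c where "c = 6 / pi ^ 2"
    have c: "0 < c" by (simp add: c_def)
    have sq: "sqrt x ^ 2 = x" using elim by simp
    \<comment> \<open>The factor 1/2 cancels because \<open>ln (sqrt x) = ln x / 2\<close>.\<close>
    have k: "sqrt x / ln x \<le> real k"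
      using elim by (simp add: k_def ln_sqrt)
    have fin: "finite ?P" "finite ?Q"
      by (rule finite_subset [of _ "{..nat \<lfloor>sqrt x\<rfloor>}"], auto simp: le_nat_floor)
        (rule finite_subset [of _ "{..nat \<lfloor>5 * sqrt x\<rfloor>}"], auto simp: le_nat_floor)
    have P0: "0 \<le> (\<Prod>p\<in>?P. 1 - 1 / real p ^ 2)"
      by (intro prod_nonneg) (auto simp: divide_le_eq_1 dest: prime_ge_1_nat)
    have "c \<le> (\<Prod>p\<in>?P \<union> ?Q. 1 - 1 / real p ^ 2)"
      unfolding c_def using fin by (intro prod_one_minus_inverse_square_ge) auto
    also have "\<dots> = (\<Prod>p\<in>?P. 1 - 1 / real p ^ 2) * (\<Prod>p\<in>?Q. 1 - 1 / real p ^ 2)"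
      using fin by (intro prod.union_disjoint) auto
    finally have PQ: "c \<le> (\<Prod>p\<in>?P. 1 - 1 / real p ^ 2) * (\<Prod>p\<in>?Q. 1 - 1 / real p ^ 2)" .
    have "(\<Prod>p\<in>?Q. 1 - 1 / real p ^ 2) * (1 + 1 / (25 * x)) ^ k
        = (\<Prod>p\<in>?Q. (1 - 1 / real p ^ 2) * (1 + 1 / (25 * x)))"
      by (simp add: k_def prod.distrib)
    also have "\<dots> \<le> 1"
    proof (intro prod_le_1 conjI)
      fix p assume p: "p \<in> ?Q"
      then have p1: "1 \<le> real p" using prime_ge_1_nat [of p] by simp
      have "real p ^ 2 \<le> (5 * sqrt x) ^ 2" using p by (intro power_mono) auto
      then have "real p ^ 2 \<le> 25 * x" using sq by (simp add: power_mult_distrib)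
      then have "1 / (25 * x) \<le> 1 / real p ^ 2"
        using p1 elim by (intro divide_left_mono mult_pos_pos) auto
      then have "(1 - 1 / real p ^ 2) * (1 + 1 / (25 * x)) \<le> (1 - 1 / (25 * x)) * (1 + 1 / (25 * x))"
        using elim by (intro mult_right_mono) auto
      also have "\<dots> = 1 - (1 / (25 * x)) ^ 2" by (simp add: algebra_simps power2_eq_square)
      finally show "(1 - 1 / real p ^ 2) * (1 + 1 / (25 * x)) \<le> 1"
        using zero_le_power2 [of "1 / (25 * x)"] by linarith
      have "1 / real p ^ 2 \<le> 1" using p1 by simp
      then show "0 \<le> (1 - 1 / real p ^ 2) * (1 + 1 / (25 * x))"
        using elim by (intro mult_nonneg_nonneg) auto
    qed
    finally have Q: "(\<Prod>p\<in>?Q. 1 - 1 / real p ^ 2) * (1 + 1 / (25 * x)) ^ k \<le> 1" .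
    have "1 + real k * (1 / (25 * x)) \<le> (1 + 1 / (25 * x)) ^ k"
    proof (rule Bernoulli_inequality)
      have "0 \<le> 1 / (25 * x)" using elim by simp
      then show "-1 \<le> 1 / (25 * x)" by linarith
    qed
    then have "c * (1 + real k * (1 / (25 * x)))
        \<le> (\<Prod>p\<in>?P. 1 - 1 / real p ^ 2) * (\<Prod>p\<in>?Q. 1 - 1 / real p ^ 2) * (1 + 1 / (25 * x)) ^ k"
      using c PQ elim by (intro mult_mono) auto
    also have "\<dots> \<le> (\<Prod>p\<in>?P. 1 - 1 / real p ^ 2) * 1"
      unfolding mult.assoc by (intro mult_left_mono Q P0)
    finally have "c * (1 + real k * (1 / (25 * x))) \<le> (\<Prod>p\<in>?P. 1 - 1 / real p ^ 2)" by simp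
    then have "(x - 1) * (c * (1 + real k * (1 / (25 * x))))
        \<le> real (nat \<lfloor>x\<rfloor>) * (\<Prod>p\<in>?P. 1 - 1 / real p ^ 2)"
    proof (intro mult_mono)
      show "x - 1 \<le> real (nat \<lfloor>x\<rfloor>)" using elim by linarith
      show "0 \<le> c * (1 + real k * (1 / (25 * x)))"
        using c elim by (intro mult_nonneg_nonneg add_nonneg_nonneg) auto
    qed simp_all
    also have "\<dots> \<le> real (max_admissible x)"
      using elim by (intro max_admissible_ge) auto
    finally have "(x - 1) * (c * (1 + real k * (1 / (25 * x)))) \<le> real (max_admissible x)" .
    \<comment> \<open>As \<open>(x - 1) / x \<ge> 1/2\<close>, the gain \<open>k / 25\<close> keeps
      at least \<open>k / 50\<close>; one half of this compensates the \<open>-1\<close>, the other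
      half remains.\<close>
    moreover have "c * x + c * (real k / 100) \<le> (x - 1) * (c * (1 + real k * (1 / (25 * x))))"
    proof -
      have k100: "100 \<le> real k" using k elim by linarith
      have "1 / 2 \<le> (x - 1) / x" using elim by (simp add: field_simps)
      then have "1 / 2 * (real k / 25) \<le> (x - 1) / x * (real k / 25)"
        by (intro mult_right_mono) auto
      then have "x + real k / 100 \<le> x - 1 + (x - 1) / x * (real k / 25)"
        using k100 by linarith
      then have "c * (x + real k / 100) \<le> c * (x - 1 + (x - 1) / x * (real k / 25))"
        using c by (intro mult_left_mono) auto
      then show ?thesis by (simp add: algebra_simps)
    qed
    ultimately have "c * (real k / 100) \<le> real (max_admissible x) - c * x" by linarith
    then have "100 / c * (c * (real k / 100)) \<le> 100 / c * (real (max_admissible x) - c * x)"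
      using c by (intro mult_left_mono) auto
    then have "real k \<le> 100 / c * (real (max_admissible x) - c * x)"
      using c by simp
    with k have "sqrt x / ln x \<le> 100 / c * (real (max_admissible x) - c * x)" by linarith
    then show ?case using elim by (simp add: c_def)
  qed
qed

section \<open>Upper bound from the quadratic sieve\<close>

text \<open>Since \<open>1 + t \<le> exp t\<close>, convergence of the sum of
  \<open>n powr (-3/2)\<close> gives a bound uniform in \<open>P\<close>.\<close>

lemma prod_one_plus_powr_bounded:
  "\<exists>K. \<forall>P. finite P \<longrightarrow> (\<Prod>p\<in>P. 1 + 3 * real p powr (-3/2)) \<le> K"
proof (intro exI allI impI)
  fix P :: "nat set" assume "finite P"
  have sm: "summable (\<lambda>n. real n powr (-3/2))"
    by (simp add: summable_real_powr_iff)
  have "(\<Prod>p\<in>P. 1 + 3 * real p powr (-3/2)) \<le> (\<Prod>p\<in>P. exp (3 * real p powr (-3/2)))"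
    by (intro prod_mono) (auto simp: exp_ge_add_one_self intro: add_nonneg_nonneg)
  also have "\<dots> = exp (3 * (\<Sum>p\<in>P. real p powr (-3/2)))"
    using \<open>finite P\<close> by (simp add: exp_sum sum_distrib_left)
  also have "\<dots> \<le> exp (3 * (\<Sum>n. real n powr (-3/2)))"
    using sum_le_suminf [OF sm \<open>finite P\<close>] by simp
  finally show "(\<Prod>p\<in>P. 1 + 3 * real p powr (-3/2)) \<le> exp (3 * (\<Sum>n. real n powr (-3/2)))" .
qed

lemma max_admissible_upper_bound:
  "\<exists>C>0. \<forall>x\<ge>1. real (max_admissible x) \<le> 6 / pi ^ 2 * x + C * x powr (4/5)"
proof -
  obtain K where K: "\<And>P. finite P \<Longrightarrow> (\<Prod>p\<in>P. 1 + 3 * real p powr (-3/2)) \<le> K"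
    using prod_one_plus_powr_bounded by blast
  have K1: "1 \<le> K" using K [of "{}"] by simp
  \<comment> \<open>In \<open>2 + K\<close>, one unit pays for cutting the Euler product off at
    \<open>z\<close>, one for \<open>D ^ 2\<close>, and \<open>K\<close> for the Rankin
    term.\<close>
  have "real (max_admissible x) \<le> 6 / pi ^ 2 * x + (2 + K) * x powr (4/5)" if x: "1 \<le> x" for x
  proof -
    define D where "D = x powr (2/5)"
    \<comment> \<open>Sieving by the primes up to about \<open>D\<close> suffices: the cut-off costs
      at most \<open>x / D = x powr (3/5)\<close>, below the target
      \<open>x powr (4/5)\<close>.\<close>
    define z where "z = nat \<lceil>D\<rceil>"
    define N where "N = nat \<lfloor>x\<rfloor>"
    let ?P = "{p. prime p \<and> p \<le> z}"
    have D: "1 \<le> D" unfolding D_def using x by (rule ge_one_powr_ge_zero) simp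
    have z: "D \<le> real z" "0 < z" using D unfolding z_def by linarith+
    have N: "real N \<le> x" using x by (simp add: N_def)
    have fin: "finite ?P" by (rule finite_subset [of _ "{..z}"]) auto
    obtain B where B: "admissible B" "card (B \<inter> initial x) = max_admissible x"
      by (rule max_admissible_attained)
    then obtain b where b: "\<And>p. prime p \<Longrightarrow> \<forall>n\<in>B. \<not> [n = b p] (mod p ^ 2)"
      unfolding admissible_def by metis
    have "real (card (B \<inter> initial x)) \<le> real N * (\<Prod>p\<in>?P. 1 - 1 / real p ^ 2)
        + real N * D powr (-1/2) * (\<Prod>p\<in>?P. 1 + 3 * real p powr (-3/2)) + D ^ 2"
      by (rule quadratic_sieve [where b = b]) (use fin b D in \<open>auto simp: initial_eq N_def\<close>)
    also have "real N * (\<Prod>p\<in>?P. 1 - 1 / real p ^ 2) \<le> 6 / pi ^ 2 * x + x powr (4/5)"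
    proof -
      have c: "6 / pi ^ 2 \<le> 1"
        using prod_one_minus_inverse_square_ge [of "{}"] by simp
      have "(\<Prod>p\<in>?P. 1 - 1 / real p ^ 2) \<le> 6 / pi ^ 2 * (1 + 1 / real z)"
        by (rule prod_one_minus_inverse_square_le [OF z(2)])
      also have "\<dots> = 6 / pi ^ 2 + 6 / pi ^ 2 * (1 / real z)"
        by (simp only: distrib_left mult_1_right)
      also have "6 / pi ^ 2 * (1 / real z) \<le> 1 * (1 / D)"
        using c z D by (intro mult_mono divide_left_mono) auto
      finally have le: "(\<Prod>p\<in>?P. 1 - 1 / real p ^ 2) \<le> 6 / pi ^ 2 + 1 / D" by simp
      have "0 \<le> (\<Prod>p\<in>?P. 1 - 1 / real p ^ 2)"
        by (rule order_trans [OF _ prod_one_minus_inverse_square_ge]) (use fin in auto)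
      then have "real N * (\<Prod>p\<in>?P. 1 - 1 / real p ^ 2) \<le> x * (6 / pi ^ 2 + 1 / D)"
        using le N x by (intro mult_mono) auto
      also have "x * (1 / D) = x powr (1 - 2/5)"
        unfolding D_def using x by (subst powr_diff) auto
      then have "x * (6 / pi ^ 2 + 1 / D) = 6 / pi ^ 2 * x + x powr (1 - 2/5)"
        by (simp add: algebra_simps)
      also have "x powr (1 - 2/5) \<le> x powr (4/5)"
        using x by (intro powr_mono) auto
      finally show ?thesis by simp
    qed
    also have "real N * D powr (-1/2) * (\<Prod>p\<in>?P. 1 + 3 * real p powr (-3/2)) \<le> K * x powr (4/5)"
    proof -
      have "real N * D powr (-1/2) * (\<Prod>p\<in>?P. 1 + 3 * real p powr (-3/2))
          \<le> x * D powr (-1/2) * K"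
        using N x by (intro mult_mono K fin prod_nonneg) auto
      also have "x * D powr (-1/2) = x powr 1 * x powr (-1/5)"
        unfolding D_def powr_powr using x by simp
      also have "\<dots> = x powr (4/5)" by (subst powr_add [symmetric]) simp
      finally show ?thesis by (simp add: mult.commute)
    qed
    also have "D ^ 2 = x powr (4/5)"
      using D unfolding D_def by (subst powr_numeral [symmetric]) (auto simp: powr_powr)
    finally show ?thesis unfolding B(2) by (simp add: algebra_simps)
  qed
  then show ?thesis using K1 by (intro exI [of _ "2 + K"]) simp
qed

section \<open>Comparison with the squarefree numbers\<close>

text \<open>The set \<open>B\<close> below contains all squarefree numbers up to \<open>x\<close>
  and also \<open>p ^ 2\<close>. It stays admissible because the class of \<open>b\<close> modulo
  \<open>p ^ 2\<close> has only the members \<open>b + j * p ^ 2\<close> with \<open>j < k\<close>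
  in \<open>[x]\<close>, and \<open>b\<close> is chosen so that the \<open>j\<close>-th one is
  divisible by \<open>q j ^ 2\<close>, hence outside \<open>B\<close>.\<close>

lemma card_SF_less_max_admissible:
  fixes q :: "nat \<Rightarrow> nat"
  assumes q: "inj q" "\<And>j. prime (q j)"
    and p: "prime p" "(\<Prod>j<k. q j ^ 2) \<le> p ^ 2" "\<And>j. j < k \<Longrightarrow> q j < p"
    and x: "real (p ^ 2) \<le> x" "x < real (k * p ^ 2)"
  shows "card (SF \<inter> initial x) < max_admissible x"
proof -
  define B where "B = {n \<in> initial x. \<forall>r. prime r \<longrightarrow> r \<noteq> p \<longrightarrow> \<not> r ^ 2 dvd n}"
  have cop: "\<forall>i\<in>{..<k}. \<forall>j\<in>{..<k}. i \<noteq> j \<longrightarrow> coprime (q i ^ 2) (q j ^ 2)"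
    using q primes_coprime [OF q(2) q(2)] by (simp add: inj_eq)
  have nz: "\<forall>j\<in>{..<k}. q j ^ 2 \<noteq> 0"
    using prime_gt_0_nat [OF q(2)] by simp
  \<comment> \<open>The factor \<open>q j ^ 2 - 1\<close> plays the role of \<open>-1\<close> modulo
    \<open>q j ^ 2\<close>, so that \<open>b\<close> is congruent to \<open>- j * p ^ 2\<close>
    within the natural numbers.\<close>
  obtain b where b: "b < (\<Prod>j<k. q j ^ 2)"
    "\<And>j. j < k \<Longrightarrow> [b = (q j ^ 2 - 1) * (j * p ^ 2)] (mod q j ^ 2)"
    using chinese_remainder_unique_nat [OF finite_lessThan nz cop,
      of "\<lambda>j. (q j ^ 2 - 1) * (j * p ^ 2)"] by auto
  have dvd: "q j ^ 2 dvd b + j * p ^ 2" if "j < k" for j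
  proof -
    have "[b + j * p ^ 2 = (q j ^ 2 - 1) * (j * p ^ 2) + j * p ^ 2] (mod q j ^ 2)"
      using b(2) [OF that] by (intro cong_add cong_refl)
    also have "(q j ^ 2 - 1) * (j * p ^ 2) + j * p ^ 2 = (q j ^ 2 - 1 + 1) * (j * p ^ 2)"
      by (simp only: add_mult_distrib mult_1)
    also have "q j ^ 2 - 1 + 1 = q j ^ 2"
      using prime_gt_0_nat [OF q(2) [of j]] by simp
    also have "[q j ^ 2 * (j * p ^ 2) = 0] (mod q j ^ 2)"
      by (simp add: cong_0_iff)
    finally show ?thesis by (simp add: cong_0_iff)
  qed
  have "\<not> [n = b] (mod p ^ 2)" if "n \<in> B" for n
  proof
    assume cong: "[n = b] (mod p ^ 2)"
    \<comment> \<open>As \<open>b\<close> is already reduced modulo \<open>p ^ 2\<close>, the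
      quotient \<open>n div p ^ 2\<close> is the index \<open>j\<close>.\<close>
    have bp: "b < p ^ 2" using b(1) p(2) by linarith
    then have "n mod p ^ 2 = b" using cong by (simp add: Cong.cong_def)
    then have n: "n = b + (n div p ^ 2) * p ^ 2"
      using div_mult_mod_eq [of n "p ^ 2"] by linarith
    have "real n < real (k * p ^ 2)" using \<open>n \<in> B\<close> x by (simp add: B_def initial_def)
    then have "n < k * p ^ 2" by (simp only: of_nat_less_iff)
    then have j: "n div p ^ 2 < k" by (simp add: less_mult_imp_div_less)
    then have "q (n div p ^ 2) ^ 2 dvd n" using dvd n by metis
    moreover have "q (n div p ^ 2) \<noteq> p" using p(3) [OF j] by simp
    ultimately show False using that q(2) by (auto simp: B_def)
  qed
  moreover have "\<forall>n\<in>B. \<not> [n = 0] (mod r ^ 2)" if "prime r" "r \<noteq> p" for r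
    using that by (auto simp: B_def cong_0_iff)
  ultimately have "admissible B"
    unfolding admissible_def by (auto simp: B_def initial_def) blast
  moreover have "B \<inter> initial x = B" by (auto simp: B_def)
  ultimately have "card B \<le> max_admissible x"
    using card_le_max_admissible by metis
  moreover have "card (SF \<inter> initial x) < card B"
  proof (rule psubset_card_mono)
    show "finite B" unfolding B_def using finite_initial [of x] by simp
    have "SF \<inter> initial x \<subseteq> B"
    proof
      fix n assume n: "n \<in> SF \<inter> initial x"
      then have "squarefree n" by (simp add: SF_def)
      then have "\<not> r ^ 2 dvd n" if "prime r" for r
        using squarefreeD not_prime_unit that by blast
      then show "n \<in> B" using n unfolding B_def by blast
    qed
    moreover have "p ^ 2 \<in> B"
    proof -
      have "r = p" if "prime r" "r ^ 2 dvd p ^ 2" for r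
        using that p(1) by (simp add: primes_dvd_imp_eq)
      then show ?thesis
        using x(1) prime_gt_0_nat [OF p(1)] by (auto simp: B_def initial_def)
    qed
    moreover have "p ^ 2 \<notin> SF"
    proof
      assume "p ^ 2 \<in> SF"
      then have "p dvd 1" using squarefreeD [of "p ^ 2" p] by (simp add: SF_def)
      then show False using p(1) not_prime_unit by blast
    qed
    ultimately show "SF \<inter> initial x \<subset> B" by blast
  qed
  ultimately show ?thesis by linarith
qed

text \<open>The Chebyshev bound supplies a prime \<open>p\<close> in
  \<open>(sqrt x / 5, sqrt x]\<close>. Then \<open>p ^ 2 \<le> x < 25 * p ^ 2\<close>, so the first
  25 primes can serve as the \<open>q j\<close>; they stay fixed while \<open>p\<close>
  grows.\<close>

lemma eventually_card_SF_less_max_admissible: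
  "eventually (\<lambda>x::real. card (SF \<inter> initial x) < max_admissible x) at_top"
proof -
  define q where "q = enumerate {p :: nat. prime p}"
  have q: "inj q" "\<And>j. prime (q j)"
    using strict_mono_enumerate [OF primes_infinite] enumerate_in_set [OF primes_infinite]
    by (auto simp: q_def strict_mono_imp_inj_on)
  define M where "M = (\<Prod>j<25. q j ^ 2)"
  have lim: "filterlim (\<lambda>x. sqrt x / 5) at_top at_top" by real_asymp
  \<comment> \<open>Makes \<open>p\<close> exceed both \<open>M\<close> and every
    \<open>q j\<close>; the summand 2 keeps \<open>ln (sqrt x / 5)\<close> positive.\<close>
  have "eventually (\<lambda>x::real. real M + (\<Sum>j<25. real (q j)) + 2 < sqrt x / 5) at_top"
    using lim unfolding filterlim_at_top_dense by blast
  moreover have "eventually (\<lambda>x. sqrt x / 5 / ln (sqrt x / 5) / 2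
      \<le> real (card {p. prime p \<and> sqrt x / 5 < real p \<and> real p \<le> 5 * (sqrt x / 5)})) at_top"
    using eventually_compose_filterlim [OF eventually_card_primes_ge lim] .
  ultimately show ?thesis
    using eventually_ge_at_top [of 1]
  proof eventually_elim
    case (elim x)
    let ?Q = "{p. prime p \<and> sqrt x / 5 < real p \<and> real p \<le> 5 * (sqrt x / 5)}"
    have q0: "0 \<le> (\<Sum>j<25. real (q j))" by (intro sum_nonneg) auto
    have "1 < sqrt x / 5" using elim(1) q0 by linarith
    then have "0 < sqrt x / 5 / ln (sqrt x / 5) / 2"
      by (intro divide_pos_pos ln_gt_zero) linarith+
    then have "0 < card ?Q" using elim(2) by linarith
    then have "?Q \<noteq> {}" by (auto simp only: card_gt_0_iff)
    then obtain p where "p \<in> ?Q" by blast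
    then have p: "prime p" "sqrt x / 5 < real p" "real p \<le> sqrt x" by simp_all
    have sq: "sqrt x ^ 2 = x" using elim(3) by simp
    show ?case
    proof (rule card_SF_less_max_admissible [OF q p(1), where k = 25])
      have "real M < real p" using elim(1) p(2) q0 by linarith
      then have "M \<le> p ^ 2" using self_le_power [of p 2] prime_ge_1_nat [OF p(1)] by simp
      then show "(\<Prod>j<25. q j ^ 2) \<le> p ^ 2" by (simp only: M_def)
      show "q j < p" if "j < 25" for j
      proof -
        have "real (q j) \<le> (\<Sum>j<25. real (q j))" using that by (intro member_le_sum) auto
        then have "real (q j) < real p" using elim(1) p(2) by linarith
        then show ?thesis by simp
      qed
      have "real p ^ 2 \<le> sqrt x ^ 2" using p(3) by (intro power_mono) auto
      then show "real (p ^ 2) \<le> x" using sq by simp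
      have "sqrt x ^ 2 < (5 * real p) ^ 2" using p(2) elim(3) by (intro power_strict_mono) auto
      then show "x < real (25 * p ^ 2)" using sq by (simp add: power_mult_distrib)
    qed
  qed
qed

theorem theorem1p10:
  "(\<exists>C > 0. eventually (\<lambda>x::real.
        \<bar>sqrt x / ln x\<bar> \<le> C * (real (max_admissible x) - 6 / pi ^ 2 * x)) at_top)
   \<and> (\<exists>C > 0. eventually (\<lambda>x::real.
        \<bar>real (max_admissible x) - 6 / pi ^ 2 * x\<bar> \<le> C * x powr (4 / 5)) at_top)
   \<and> eventually (\<lambda>x::real. max_admissible x > card (SF \<inter> initial x)) at_top"
proof (intro conjI)
  show "\<exists>C > 0. eventually (\<lambda>x::real.
        \<bar>sqrt x / ln x\<bar> \<le> C * (real (max_admissible x) - 6 / pi ^ 2 * x)) at_top"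
    using max_admissible_lower_bound by (intro exI [of _ "100 * pi ^ 2 / 6"] conjI) auto
  obtain C where C: "0 < C"
    "\<And>x. 1 \<le> x \<Longrightarrow> real (max_admissible x) \<le> 6 / pi ^ 2 * x + C * x powr (4/5)"
    using max_admissible_upper_bound by blast
  have "eventually (\<lambda>x::real.
        \<bar>real (max_admissible x) - 6 / pi ^ 2 * x\<bar> \<le> C * x powr (4 / 5)) at_top"
    using max_admissible_lower_bound eventually_ge_at_top [of 1]
  proof eventually_elim
    case (elim x)
    have "0 \<le> (100 * pi ^ 2 / 6) * (real (max_admissible x) - 6 / pi ^ 2 * x)"
      using elim(1) abs_ge_zero order_trans by blast
    then have "0 \<le> real (max_admissible x) - 6 / pi ^ 2 * x"
      by (simp add: zero_le_mult_iff)
    then show ?case using C(2) [OF elim(2)] by simp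
  qed
  with C(1) show "\<exists>C > 0. eventually (\<lambda>x::real.
        \<bar>real (max_admissible x) - 6 / pi ^ 2 * x\<bar> \<le> C * x powr (4 / 5)) at_top"
    by blast
  show "eventually (\<lambda>x::real. max_admissible x > card (SF \<inter> initial x)) at_top"
    by (rule eventually_card_SF_less_max_admissible)
qed

end
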